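(* There exists a torsion-free abelian group $G$ that is Bassian-finite but not relatively co-Hopfian.
   Context: All groups are abelian, written additively. A group $G$ is Bassian-finite if there is no monomorphism from $G$ to any proper direct summand of $G$ (a direct summand different from $G$). A group $G$ is relatively co-Hopfian if for every monomorphism $\phi:G\to G$, the subgroup $\phi(G)$ is essential in $G$, i.e. $\phi(G)\cap B\neq\{0\}$ for every non-zero subgroup $B\leq G$. *)

theory Defs
  imports "HOL-Algebra.Algebra"
begin

text \<open>
  Abelian groups are the library's \<open>comm_group\<close>, which is written multiplicatively: the identity
  \<open>\<one>\<close> is the additive zero, \<open>x [^] n\<close> is the multiple \<open>nx\<close>, and \<open>H <#> K\<close> is the sum \<open>H + K\<close>.
\<close>

definition torsion_free :: "('a, 'b) monoid_scheme \<Rightarrow> bool" where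
  "torsion_free G \<longleftrightarrow>
     (\<forall>x \<in> carrier G. \<forall>n::nat. n > 0 \<longrightarrow> x [^]\<^bsub>G\<^esub> n = \<one>\<^bsub>G\<^esub> \<longrightarrow> x = \<one>\<^bsub>G\<^esub>)"

definition direct_summand :: "'a set \<Rightarrow> ('a, 'b) monoid_scheme \<Rightarrow> bool" where
  "direct_summand H G \<longleftrightarrow>
     subgroup H G \<and>
     (\<exists>K. subgroup K G \<and> H \<inter> K = {\<one>\<^bsub>G\<^esub>} \<and> H <#>\<^bsub>G\<^esub> K = carrier G)"

definition Bassian_finite :: "('a, 'b) monoid_scheme \<Rightarrow> bool" where
  "Bassian_finite G \<longleftrightarrow>
     \<not> (\<exists>H f. direct_summand H G \<and> H \<noteq> carrier G \<and> f \<in> mon G (G\<lparr>carrier := H\<rparr>))"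

definition essential_subgroup :: "'a set \<Rightarrow> ('a, 'b) monoid_scheme \<Rightarrow> bool" where
  "essential_subgroup A G \<longleftrightarrow>
     subgroup A G \<and> (\<forall>B. subgroup B G \<longrightarrow> B \<noteq> {\<one>\<^bsub>G\<^esub>} \<longrightarrow> A \<inter> B \<noteq> {\<one>\<^bsub>G\<^esub>})"

definition relatively_co_Hopfian :: "('a, 'b) monoid_scheme \<Rightarrow> bool" where
  "relatively_co_Hopfian G \<longleftrightarrow> (\<forall>f \<in> mon G G. essential_subgroup (f ` carrier G) G)"

end

theory Submission
  imports Defs "HOL-Computational_Algebra.Polynomial" "HOL-Library.Countable" "HOL-Library.Product_Plus"
begin

text \<open>
  An indecomposable non-zero group is Bassian-finite, so it suffices to find an indecomposable
  torsion-free group with an injective endomorphism whose image misses a non-zero subgroup.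
  Let \<open>V = \<rat>[x]\<close> and consider in \<open>V \<times> V\<close> the subspaces \<open>V \<times> 0\<close>, \<open>0 \<times> V\<close>, the diagonal and the graph
  of multiplication by \<open>x\<close>. A linear map preserving all four is multiplication by an element of \<open>V\<close>, and
  the only idempotents of \<open>V\<close> are \<open>0\<close> and \<open>1\<close>. To make group endomorphisms preserve the four
  subspaces, assign to them the primes 2, 3, 5, 7 and let \<open>G\<close> be the set of those \<open>v\<close> whose image modulo
  the \<open>p\<close>-th subspace is \<open>p\<close>-integral for each of these \<open>p\<close>: the elements of \<open>G\<close> in the \<open>p\<close>-th subspace
  are then exactly those divisible by all powers of \<open>p\<close>. Multiplication by \<open>x\<close> is an injective endomorphism
  of \<open>G\<close>, and its image contains no non-zero pair of constants.
\<close>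

hide_const (open) Divisibility.prime

section \<open>Groups on an injective image of an additive group\<close>

definition add_subgroup :: "'a::ab_group_add set \<Rightarrow> bool" where
  "add_subgroup S \<longleftrightarrow> 0 \<in> S \<and> (\<forall>x\<in>S. \<forall>y\<in>S. x - y \<in> S)"

lemma add_subgroup_uminus: "add_subgroup S \<Longrightarrow> x \<in> S \<Longrightarrow> - x \<in> S"
  unfolding add_subgroup_def by (metis diff_0)

lemma add_subgroup_add: "add_subgroup S \<Longrightarrow> x \<in> S \<Longrightarrow> y \<in> S \<Longrightarrow> x + y \<in> S"
  using add_subgroup_uminus[of S y] unfolding add_subgroup_def by (metis diff_minus_eq_add)

definition add_indecomposable :: "'a::ab_group_add set \<Rightarrow> bool" where
  "add_indecomposable S \<longleftrightarrow>
     (\<forall>A B. add_subgroup A \<longrightarrow> add_subgroup B \<longrightarrow> A \<inter> B = {0} \<longrightarrow>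
        {a + b |a b. a \<in> A \<and> b \<in> B} = S \<longrightarrow> A = {0} \<or> A = S)"

text \<open>The theorem asks for a group on a prescribed type, while the construction lives in
  rational polynomial pairs. An injection \<open>e\<close> with left inverse \<open>d\<close>
  carries the addition over, so every property can be checked on \<open>S\<close>.\<close>

locale transported =
  fixes e :: "'a::ab_group_add \<Rightarrow> 'b" and d :: "'b \<Rightarrow> 'a" and S :: "'a set"
    and G :: "'b monoid"
  defines "G \<equiv> \<lparr>carrier = e ` S, monoid.mult = (\<lambda>x y. e (d x + d y)), one = e 0\<rparr>"
  assumes d_e [simp]: "d (e x) = x" and S: "add_subgroup S"
begin

lemma carrier_G: "carrier G = e ` S" and mult_G: "x \<otimes>\<^bsub>G\<^esub> y = e (d x + d y)" and one_G: "\<one>\<^bsub>G\<^esub> = e 0"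
  by (simp_all add: G_def)

lemma e_inject [simp]: "e x = e y \<longleftrightarrow> x = y"
  by (metis d_e)

lemma inj_e: "inj e"
  by (simp add: inj_on_def)

lemma comm_group_G: "comm_group G"
proof (rule comm_groupI)
  fix x assume "x \<in> carrier G"
  then obtain a where a: "x = e a" "a \<in> S" by (auto simp: carrier_G)
  then show "\<exists>y\<in>carrier G. y \<otimes>\<^bsub>G\<^esub> x = \<one>\<^bsub>G\<^esub>"
    using S by (intro bexI[of _ "e (- a)"]) (auto simp: carrier_G mult_G one_G add_subgroup_uminus)
qed (use S in \<open>auto simp: carrier_G mult_G one_G add_subgroup_add add_subgroup_def ac_simps\<close>)

lemma inv_G: assumes "a \<in> S" shows "inv\<^bsub>G\<^esub> (e a) = e (- a)"
proof -
  interpret comm_group G by (rule comm_group_G)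
  show ?thesis
    using assms S by (intro inv_equality) (auto simp: carrier_G mult_G one_G add_subgroup_uminus)
qed

lemma pow_G: "e a [^]\<^bsub>G\<^esub> (n::nat) = e (((+) a ^^ n) 0)"
  by (induction n) (simp_all add: nat_pow_def mult_G one_G add.commute)

lemma subgroup_image:
  assumes "add_subgroup A" "A \<subseteq> S"
  shows "subgroup (e ` A) G"
  using assms S comm_group_G
  by (intro group.subgroupI comm_group.axioms(2))
     (auto simp: carrier_G mult_G inv_G subset_iff add_subgroup_add add_subgroup_uminus
        add_subgroup_def)

lemma subgroupE_G:
  assumes "subgroup H G"
  obtains A where "add_subgroup A" "A \<subseteq> S" "H = e ` A"
proof
  interpret comm_group G by (rule comm_group_G)
  have H: "H \<subseteq> e ` S" using subgroup.subset[OF assms] by (simp add: carrier_G)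
  then show "d ` H \<subseteq> S" "H = e ` d ` H" by (auto simp: image_iff subset_iff) (metis d_e)+
  have "d x - d y \<in> d ` H" if xy: "x \<in> H" "y \<in> H" for x y
  proof -
    obtain b where b: "y = e b" "b \<in> S" using H xy by auto
    have "x \<otimes>\<^bsub>G\<^esub> inv\<^bsub>G\<^esub> y \<in> H"
      using assms xy by (simp add: subgroup.m_closed subgroup.m_inv_closed)
    then have "e (d x - d y) \<in> H" using b by (simp add: inv_G mult_G)
    then show ?thesis by (metis d_e imageI)
  qed
  moreover have "0 \<in> d ` H"
    using subgroup.one_closed[OF assms] by (metis one_G d_e imageI)
  ultimately show "add_subgroup (d ` H)" by (auto simp: add_subgroup_def)
qed

lemma torsion_free_G:
  assumes "\<And>a n. a \<in> S \<Longrightarrow> n > 0 \<Longrightarrow> ((+) a ^^ n) 0 = 0 \<Longrightarrow> a = 0"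
  shows "torsion_free G"
  using assms by (auto simp: torsion_free_def carrier_G pow_G one_G)

lemma Bassian_finite_G:
  assumes ind: "add_indecomposable S" and b: "b \<in> S" "b \<noteq> 0"
  shows "Bassian_finite G"
  unfolding Bassian_finite_def
proof clarify
  fix H f
  assume "direct_summand H G" and ne: "H \<noteq> carrier G" and f: "f \<in> mon G (G\<lparr>carrier := H\<rparr>)"
  then obtain K where H: "subgroup H G" and K: "subgroup K G"
    and inter: "H \<inter> K = {\<one>\<^bsub>G\<^esub>}" and sum: "H <#>\<^bsub>G\<^esub> K = carrier G"
    by (auto simp: direct_summand_def)
  obtain A where A: "add_subgroup A" "A \<subseteq> S" "H = e ` A" using subgroupE_G[OF H] .
  obtain B where B: "add_subgroup B" "B \<subseteq> S" "K = e ` B" using subgroupE_G[OF K] .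
  have "e ` (A \<inter> B) = e ` {0}" using inter A B by (simp add: one_G image_Int[OF inj_e])
  then have AB: "A \<inter> B = {0}" by (simp only: inj_image_eq_iff[OF inj_e])
  have "e ` {a + b |a b. a \<in> A \<and> b \<in> B} = e ` S"
    unfolding carrier_G[symmetric] sum[symmetric] A(3) B(3) set_mult_def mult_G by auto
  then have "{a + b |a b. a \<in> A \<and> b \<in> B} = S" by (simp only: inj_image_eq_iff[OF inj_e])
  moreover have "A \<noteq> S" using ne A by (auto simp: carrier_G)
  ultimately have A0: "A = {0}" using ind A(1) B(1) AB unfolding add_indecomposable_def by blast
  \<comment> \<open>\<open>H\<close> is now the single point \<open>e 0\<close>, so \<open>f\<close>
    would identify \<open>e 0\<close> and \<open>e b\<close>.\<close>
  have "f (e 0) \<in> H" "f (e b) \<in> H" and inj: "inj_on f (e ` S)" and "0 \<in> S"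
    using f b S by (auto simp: mon_def hom_def carrier_G add_subgroup_def)
  then show False using A A0 b inj_onD[OF inj, of "e 0" "e b"] by auto
qed

lemma not_relatively_co_Hopfian_G:
  assumes \<phi>: "\<phi> ` S \<subseteq> S" "inj_on \<phi> S" "\<And>x y. x \<in> S \<Longrightarrow> y \<in> S \<Longrightarrow> \<phi> (x + y) = \<phi> x + \<phi> y"
    and B: "add_subgroup B" "B \<subseteq> S" "B \<noteq> {0}" "\<phi> ` S \<inter> B = {0}"
  shows "\<not> relatively_co_Hopfian G"
proof
  assume hopf: "relatively_co_Hopfian G"
  let ?f = "\<lambda>x. e (\<phi> (d x))"
  have "?f \<in> mon G G"
    using \<phi> by (auto simp: mon_def hom_def carrier_G mult_G inj_on_def)
  then have "essential_subgroup (?f ` carrier G) G"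
    using hopf by (simp add: relatively_co_Hopfian_def)
  moreover have "e ` B \<noteq> {\<one>\<^bsub>G\<^esub>}"
    using B(3) inj_image_eq_iff[OF inj_e, of B "{0}"] by (simp add: one_G)
  ultimately have "?f ` carrier G \<inter> e ` B \<noteq> {\<one>\<^bsub>G\<^esub>}"
    using subgroup_image[OF B(1,2)] by (simp add: essential_subgroup_def)
  moreover have "?f ` carrier G \<inter> e ` B = e ` (\<phi> ` S \<inter> B)"
    by (auto simp: carrier_G image_image)
  ultimately show False using B(4) by (simp add: one_G)
qed

end

section \<open>Localised integrality\<close>

text \<open>\<open>loc p\<close> is the localisation of the integers at the prime \<open>p\<close>.\<close>

definition loc :: "int \<Rightarrow> rat set" where
  "loc p = {c. \<exists>m. \<not> p dvd m \<and> of_int m * c \<in> \<int>}"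

lemma Ints_loc: "prime p \<Longrightarrow> c \<in> \<int> \<Longrightarrow> c \<in> loc p"
  unfolding loc_def by (auto intro!: exI[of _ 1] dest: not_prime_unit)

lemma loc_diff:
  assumes "prime p" "c \<in> loc p" "c' \<in> loc p"
  shows "c - c' \<in> loc p"
proof -
  obtain m m' where m: "\<not> p dvd m" "of_int m * c \<in> \<int>" and m': "\<not> p dvd m'" "of_int m' * c' \<in> \<int>"
    using assms by (auto simp: loc_def)
  have "of_int (m * m') * (c - c') = of_int m' * (of_int m * c) - of_int m * (of_int m' * c')"
    by (simp add: algebra_simps)
  also have "\<dots> \<in> \<int>" by (rule Ints_diff[OF Ints_mult[OF Ints_of_int m(2)] Ints_mult[OF Ints_of_int m'(2)]])
  finally show ?thesis
    using assms(1) m(1) m'(1) unfolding loc_def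
    by (intro CollectI exI[of _ "m * m'"]) (auto simp: prime_dvd_mult_iff)
qed

text \<open>Powers of \<open>p\<close> are admissible denominators at any other prime
  \<open>q\<close>.\<close>

lemma loc_div_power:
  assumes "prime p" "prime q" "p \<noteq> q" "c \<in> loc q"
  shows "c / of_int p ^ k \<in> loc q"
proof -
  obtain m where m: "\<not> q dvd m" "of_int m * c \<in> \<int>"
    using assms by (auto simp: loc_def)
  have "\<not> q dvd m * p ^ k"
    using assms m by (metis prime_dvd_mult_iff prime_dvd_power primes_dvd_imp_eq)
  moreover have "of_int (m * p ^ k) * (c / of_int p ^ k) = of_int m * c"
    using assms(1) by auto
  ultimately show ?thesis using m unfolding loc_def by (metis (mono_tags, lifting) mem_Collect_eq)
qed

text \<open>A non-zero rational has a finite \<open>p\<close>-adic valuation.\<close>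

lemma loc_infinitely_divisible:
  assumes "prime p" "\<And>k. \<exists>c'\<in>loc p. c = of_int p ^ k * c'"
  shows "c = 0"
proof -
  obtain a b where ab: "c = of_int a / of_int b" "b > 0"
    by (metis quotient_of_div quotient_of_denom_pos surj_pair)
  \<comment> \<open>This exponent gives \<open>p ^ k\<close> \<ge> \<open>2 ^ k\<close> >
    \<bar>a\<bar>, so divisibility of \<open>a\<close> by \<open>p ^ k\<close> forces
    \<open>a = 0\<close>.\<close>
  define k where "k = nat \<bar>a\<bar>"
  obtain c' m where c': "c = of_int p ^ k * c'" and m: "\<not> p dvd m" "of_int m * c' \<in> \<int>"
    using assms(2)[of k] by (auto simp: loc_def)
  obtain z where z: "of_int m * c' = of_int z" using m(2) by (auto elim: Ints_cases)
  have "(of_int (m * a) :: rat) = of_int m * c * of_int b" using ab by simp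
  also have "\<dots> = of_int (p ^ k * (z * b))" using z by (simp add: c' flip: z)
  finally have "p ^ k dvd m * a" by (metis dvd_triv_left of_int_eq_iff)
  moreover have "coprime (p ^ k) m" using assms(1) m(1) by (simp add: prime_imp_coprime)
  ultimately have "p ^ k dvd a" using coprime_dvd_mult_right_iff by blast
  moreover have "\<bar>a\<bar> < p ^ k"
  proof -
    have "int k < 2 ^ k" by (rule of_nat_less_two_power)
    also have "\<dots> \<le> p ^ k" using prime_ge_2_int[OF assms(1)] by (intro power_mono) auto
    finally show ?thesis by (simp add: k_def)
  qed
  ultimately have "a = 0" using zdvd_imp_le[of "p ^ k" "\<bar>a\<bar>"] by fastforce
  then show ?thesis by (simp add: ab)
qed

section \<open>Indecomposability via projections\<close>

text \<open>A decomposition into \<open>A\<close> and \<open>B\<close> yields the projection onto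
  \<open>A\<close> along \<open>B\<close>, an idempotent endomorphism. It is zero only if
  \<open>A = {0}\<close> and the identity only if \<open>A = S\<close>.\<close>

lemma add_indecomposableI:
  fixes S :: "'a::ab_group_add set"
  assumes \<pi>: "\<And>\<pi>. \<pi> ` S \<subseteq> S \<Longrightarrow> (\<And>x y. x \<in> S \<Longrightarrow> y \<in> S \<Longrightarrow> \<pi> (x + y) = \<pi> x + \<pi> y) \<Longrightarrow>
    (\<And>x. x \<in> S \<Longrightarrow> \<pi> (\<pi> x) = \<pi> x) \<Longrightarrow> (\<forall>x\<in>S. \<pi> x = 0) \<or> (\<forall>x\<in>S. \<pi> x = x)"
  shows "add_indecomposable S"
  unfolding add_indecomposable_def
proof (intro allI impI)
  fix A B :: "'a set"
  assume A: "add_subgroup A" and B: "add_subgroup B" and AB: "A \<inter> B = {0}"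
    and sum: "{a + b |a b. a \<in> A \<and> b \<in> B} = S"
  define \<pi> where "\<pi> x = (SOME a. a \<in> A \<and> x - a \<in> B)" for x
  have AS: "A \<subseteq> S" using sum B by (force simp: add_subgroup_def)
  \<comment> \<open>Two candidates differ by an element of both \<open>A\<close> and
    \<open>B\<close>, hence by 0.\<close>
  have \<pi>_eq: "\<pi> x = a" if "a \<in> A" "x - a \<in> B" for x a
    unfolding \<pi>_def
  proof (rule some_equality)
    fix a' assume a': "a' \<in> A \<and> x - a' \<in> B"
    have "a' - a \<in> A" using A that a' by (auto simp: add_subgroup_def)
    moreover have "(x - a) - (x - a') \<in> B" using B that a' unfolding add_subgroup_def by blast
    ultimately have "a' - a \<in> A \<inter> B" by simp
    then show "a' = a" using AB by simp
  qed (use that in simp)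
  have \<pi>: "\<pi> x \<in> A" "x - \<pi> x \<in> B" if x: "x \<in> S" for x
  proof -
    obtain a b where "x = a + b" "a \<in> A" "b \<in> B" using x sum by auto
    then show "\<pi> x \<in> A" "x - \<pi> x \<in> B" using \<pi>_eq[of a x] by simp_all
  qed
  have \<pi>A: "\<pi> a = a" if "a \<in> A" for a
    using that B by (intro \<pi>_eq) (auto simp: add_subgroup_def)
  have "(\<forall>x\<in>S. \<pi> x = 0) \<or> (\<forall>x\<in>S. \<pi> x = x)"
  proof (rule assms)
    show "\<pi> ` S \<subseteq> S" using \<pi> AS by auto
    show "\<pi> (\<pi> x) = \<pi> x" if "x \<in> S" for x using \<pi>A \<pi> that by simp
    show "\<pi> (x + y) = \<pi> x + \<pi> y" if "x \<in> S" "y \<in> S" for x y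
      using \<pi>[OF that(1)] \<pi>[OF that(2)] A B
      by (intro \<pi>_eq) (auto simp: add_subgroup_add add_diff_add)
  qed
  then show "A = {0} \<or> A = S"
  proof
    assume "\<forall>x\<in>S. \<pi> x = 0"
    then have "A \<subseteq> {0}" using AS \<pi>A by force
    then show ?thesis using A by (auto simp: add_subgroup_def)
  next
    assume "\<forall>x\<in>S. \<pi> x = x"
    then have "S \<subseteq> A" using \<pi> by force
    then show ?thesis using AS by auto
  qed
qed

section \<open>The four-subspace group\<close>

text \<open>The kernels of \<open>fun4 2\<close>, \<open>fun4 3\<close>, \<open>fun4 5\<close>, \<open>fun4 7\<close> are the four subspaces.\<close>

definition fun4 :: "int \<Rightarrow> rat poly \<times> rat poly \<Rightarrow> rat poly" where
  "fun4 p v = (if p = 2 then snd v else if p = 3 then fst v else if p = 5 then fst v - snd v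
     else snd v - pCons 0 (fst v))"

definition four_group :: "(rat poly \<times> rat poly) set" where
  "four_group = {v. \<forall>p\<in>{2, 3, 5, 7}. \<forall>i. poly.coeff (fun4 p v) i \<in> loc p}"

definition scale :: "rat \<Rightarrow> rat poly \<times> rat poly \<Rightarrow> rat poly \<times> rat poly" where
  "scale r v = (smult r (fst v), smult r (snd v))"

definition shift :: "rat poly \<times> rat poly \<Rightarrow> rat poly \<times> rat poly" where
  "shift v = (pCons 0 (fst v), pCons 0 (snd v))"

abbreviation rpoly :: "int poly \<Rightarrow> rat poly" where
  "rpoly \<equiv> map_poly of_int"

lemma fun4_simps:
  "fun4 2 v = snd v" "fun4 3 v = fst v" "fun4 5 v = fst v - snd v"
  "fun4 7 v = snd v - pCons 0 (fst v)"
  by (simp_all add: fun4_def)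

lemma fun4_diff: "fun4 p (v - w) = fun4 p v - fun4 p w"
  by (auto simp: fun4_def)

lemma fun4_scale: "fun4 p (scale r v) = smult r (fun4 p v)"
  by (auto simp: fun4_def scale_def smult_diff_right)

lemma fun4_shift: "fun4 p (shift v) = pCons 0 (fun4 p v)"
  by (auto simp: fun4_def shift_def)

lemma prime_2357: "p \<in> {2, 3, 5, 7} \<Longrightarrow> prime (p::int)"
  by (auto simp: prime_int_numeral_eq prime_nat_numeral_eq)

lemma zero_in_loc: "p \<in> {2, 3, 5, 7} \<Longrightarrow> 0 \<in> loc p"
  by (simp add: Ints_loc prime_2357)

lemma add_subgroup_four_group: "add_subgroup four_group"
  unfolding add_subgroup_def four_group_def
  using loc_diff prime_2357 zero_in_loc by (auto simp: fun4_diff) (auto simp: fun4_def)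

lemma shift_four_group: "v \<in> four_group \<Longrightarrow> shift v \<in> four_group"
  unfolding four_group_def using zero_in_loc
  by (auto simp: fun4_shift coeff_pCons split: nat.split)

lemma coeff_rpoly: "poly.coeff (rpoly F) i = of_int (poly.coeff F i)"
  by (simp add: coeff_map_poly)

lemma rpoly_pCons [simp]: "rpoly (pCons a F) = pCons (of_int a) (rpoly F)"
  by (simp add: map_poly_pCons)

lemma rpoly_in_four_group: "(rpoly F, rpoly H) \<in> four_group"
proof -
  have "poly.coeff (fun4 p (rpoly F, rpoly H)) i \<in> \<int>" for p i
    by (auto simp: fun4_def coeff_rpoly coeff_pCons split: nat.split)
  then show ?thesis by (auto simp: four_group_def intro!: Ints_loc prime_2357)
qed

section \<open>Clearing denominators\<close>

lemma rat_poly_common_denominator: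
  fixes f :: "rat poly"
  obtains n F where "n > 0" "smult (of_int n) f = rpoly F"
proof -
  have "\<exists>n>0. \<exists>F. smult (of_int n) f = rpoly F"
  proof (induction f)
    case 0
    then show ?case by (intro exI[of _ 1]) (auto intro: exI[of _ 0])
  next
    case (pCons a f)
    obtain n F where n: "n > 0" "smult (of_int n) f = rpoly F" using pCons by auto
    obtain s t where st: "a = of_int s / of_int t" "t > 0"
      by (metis quotient_of_div quotient_of_denom_pos surj_pair)
    have "smult (of_int (t * n)) (pCons a f) = rpoly (pCons (n * s) (smult t F))"
      using n st by (auto simp: poly_eq_iff coeff_rpoly coeff_pCons split: nat.split)
    then show ?case using n st by (meson mult_pos_pos)
  qed
  then show ?thesis using that by blast
qed

lemma pair_common_denominator:
  obtains n F H where "n > 0" "scale (of_int n) v = (rpoly F, rpoly H)"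
proof -
  obtain n F where n: "n > 0" "smult (of_int n) (fst v) = rpoly F"
    using rat_poly_common_denominator .
  obtain m H where m: "m > 0" "smult (of_int m) (snd v) = rpoly H"
    using rat_poly_common_denominator .
  have "smult (of_int (n * m)) (fst v) = rpoly (smult m F)"
    "smult (of_int (n * m)) (snd v) = rpoly (smult n H)"
    using n m by (auto simp: poly_eq_iff coeff_rpoly)
  then have "scale (of_int (n * m)) v = (rpoly (smult m F), rpoly (smult n H))"
    by (simp add: scale_def)
  then show ?thesis using that n m by (meson mult_pos_pos)
qed

section \<open>Idempotent endomorphisms of the four-subspace group\<close>

locale four_group_projection =
  fixes \<pi> :: "rat poly \<times> rat poly \<Rightarrow> rat poly \<times> rat poly"
  assumes closed: "v \<in> four_group \<Longrightarrow> \<pi> v \<in> four_group"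
    and add: "v \<in> four_group \<Longrightarrow> w \<in> four_group \<Longrightarrow> \<pi> (v + w) = \<pi> v + \<pi> w"
    and idem: "v \<in> four_group \<Longrightarrow> \<pi> (\<pi> v) = \<pi> v"
begin

lemma scale_int:
  assumes v: "v \<in> four_group"
  shows "scale (of_int n) v \<in> four_group \<and> \<pi> (scale (of_int n) v) = scale (of_int n) (\<pi> v)"
proof -
  note S = add_subgroup_four_group
  have zero: "0 \<in> four_group" using S by (simp add: add_subgroup_def)
  have "\<pi> 0 = 0" using add[OF zero zero] by simp
  have split: "scale (of_int (i + 1)) u = scale (of_int i) u + u" for i u
    by (simp add: scale_def prod_eq_iff smult_add_left)
  have split': "scale (of_int i) u = scale (of_int (i - 1)) u + u" for i u
    using split[of "i - 1" u] by simp
  show ?thesis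
  proof (induction n rule: int_induct[where k = 0])
    case base
    then show ?case using zero \<open>\<pi> 0 = 0\<close> by (simp add: scale_def zero_prod_def)
  next
    case (step1 i)
    then show ?case using v S by (simp only: split add add_subgroup_add)
  next
    case (step2 i)
    \<comment> \<open>Going down, membership comes first by subtraction; additivity on the sum of
      \<open>i - 1\<close> copies and one more then lets \<open>\<pi> v\<close> be
      cancelled.\<close>
    have "scale (of_int (i - 1)) v = scale (of_int i) v - v" using split'[of i v] by simp
    then have in4: "scale (of_int (i - 1)) v \<in> four_group"
      using step2 v S by (simp add: add_subgroup_def)
    have "\<pi> (scale (of_int i) v) = \<pi> (scale (of_int (i - 1)) v) + \<pi> v"
      using add[OF in4 v] split'[of i v] by simp
    then show ?case using in4 step2 split'[of i "\<pi> v"] by simp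
  qed
qed

text \<open>Additive maps preserve divisibility by all powers of \<open>p\<close>, and this
  divisibility characterises the \<open>p\<close>-th subspace inside the group.\<close>

lemma kernel_invariant:
  assumes p: "p \<in> {2, 3, 5, 7}" and v: "v \<in> four_group" "fun4 p v = 0"
  shows "fun4 p (\<pi> v) = 0"
proof (rule poly_eqI)
  fix i
  have "\<exists>c'\<in>loc p. poly.coeff (fun4 p (\<pi> v)) i = of_int p ^ k * c'" for k
  proof -
    \<comment> \<open>Division by \<open>p ^ k\<close> stays in the group: the condition at
      \<open>p\<close> is void since \<open>fun4 p v = 0\<close>, and the other primes tolerate the
      denominator.\<close>
    define w where "w = scale (1 / of_int p ^ k) v"
    have "poly.coeff (fun4 q w) j \<in> loc q" if q: "q \<in> {2, 3, 5, 7}" for q j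
    proof (cases "q = p")
      case True
      then show ?thesis using v zero_in_loc[OF p] by (simp add: w_def fun4_scale)
    next
      case False
      then have "poly.coeff (fun4 q v) j / of_int p ^ k \<in> loc q"
        using v q p by (intro loc_div_power prime_2357) (auto simp: four_group_def)
      then show ?thesis by (simp add: w_def fun4_scale)
    qed
    then have w: "w \<in> four_group" by (simp add: four_group_def)
    have "p \<noteq> 0" using p by auto
    then have "v = scale (of_int (p ^ k)) w" by (simp add: w_def scale_def)
    then have "\<pi> v = scale (of_int (p ^ k)) (\<pi> w)" using scale_int[OF w] by metis
    then have "poly.coeff (fun4 p (\<pi> v)) i = of_int p ^ k * poly.coeff (fun4 p (\<pi> w)) i"
      by (simp add: fun4_scale)
    moreover have "poly.coeff (fun4 p (\<pi> w)) i \<in> loc p"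
      using closed[OF w] p unfolding four_group_def by blast
    ultimately show ?thesis by blast
  qed
  then show "poly.coeff (fun4 p (\<pi> v)) i = poly.coeff 0 i"
    using loc_infinitely_divisible[OF prime_2357[OF p]] by simp
qed

text \<open>Integer polynomials serve as arguments because they satisfy all four integrality
  conditions automatically.\<close>

definition act :: "int poly \<Rightarrow> rat poly" where
  "act F = fst (\<pi> (rpoly F, 0))"

text \<open>
  Preserving the two factors makes \<open>\<pi>\<close> diagonal, preserving the diagonal makes both entries equal,
  and preserving the graph of multiplication by \<open>x\<close> makes the entry commute with \<open>x\<close>.
\<close>

lemma proj_left: "\<pi> (rpoly F, 0) = (act F, 0)"
  using kernel_invariant[of 2 "(rpoly F, 0)"] rpoly_in_four_group[of F 0]
  by (simp add: fun4_simps act_def prod_eq_iff)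

lemma proj_right: "\<pi> (0, rpoly F) = (0, act F)"
proof -
  have "\<pi> (rpoly F, rpoly F) = \<pi> (rpoly F, 0) + \<pi> (0, rpoly F)"
    using add[of "(rpoly F, 0)" "(0, rpoly F)"] rpoly_in_four_group[of F 0]
      rpoly_in_four_group[of 0 F] by simp
  then show ?thesis
    using kernel_invariant[of 5 "(rpoly F, rpoly F)"] rpoly_in_four_group[of F F]
      kernel_invariant[of 3 "(0, rpoly F)"] rpoly_in_four_group[of 0 F]
    by (simp add: fun4_simps proj_left prod_eq_iff)
qed

lemma proj_pair: "\<pi> (rpoly F, rpoly H) = (act F, act H)"
  using add[of "(rpoly F, 0)" "(0, rpoly H)"] rpoly_in_four_group[of F 0]
    rpoly_in_four_group[of 0 H] by (simp add: proj_left proj_right)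

lemma act_shift: "act (pCons 0 F) = pCons 0 (act F)"
  using kernel_invariant[of 7 "(rpoly F, rpoly (pCons 0 F))"]
    rpoly_in_four_group[of F "pCons 0 F"]
  unfolding proj_pair by (simp add: fun4_simps)

lemma act_const: "act [:k:] = smult (of_int k) (act 1)"
proof -
  have "(rpoly [:k:], 0) = scale (of_int k) (rpoly 1, 0)"
    by (simp add: scale_def one_pCons)
  then have "\<pi> (rpoly [:k:], 0) = scale (of_int k) (\<pi> (rpoly 1, 0))"
    using scale_int[of "(rpoly 1, 0)" k] rpoly_in_four_group[of 1 0] by simp
  then show ?thesis by (simp only: proj_left) (simp add: scale_def)
qed

lemma act_add: "act (F + H) = act F + act H"
proof -
  have "rpoly (F + H) = rpoly F + rpoly H" by (simp add: poly_eq_iff coeff_rpoly)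
  then show ?thesis
    using add[of "(rpoly F, 0)" "(rpoly H, 0)"] rpoly_in_four_group[of F 0]
      rpoly_in_four_group[of H 0] proj_left[of "F + H"] by (simp add: proj_left)
qed

text \<open>Being additive and commuting with multiplication by \<open>x\<close>, \<open>act\<close>
  is linear over the integer polynomials, so its value at 1 determines it.\<close>

lemma act_eq_mult: "act F = rpoly F * act 1"
proof (induction F)
  case 0
  show ?case using act_const[of 0] by simp
next
  case (pCons k F)
  have "act (pCons k F) = act ([:k:] + pCons 0 F)" by simp
  also have "\<dots> = smult (of_int k) (act 1) + pCons 0 (act F)"
    by (simp only: act_add act_const act_shift)
  finally show ?case using pCons by (simp add: mult_pCons_left)
qed

text \<open>Some positive multiple of \<open>v\<close> is an integral pair, where the formula is
  known; the multiplier cancels.\<close>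

lemma proj_eq_mult:
  assumes v: "v \<in> four_group"
  shows "\<pi> v = (fst v * act 1, snd v * act 1)"
proof -
  obtain n F H where n: "n > 0" "scale (of_int n) v = (rpoly F, rpoly H)"
    using pair_common_denominator .
  then have "scale (of_int n) (\<pi> v) = (rpoly F * act 1, rpoly H * act 1)"
    using scale_int[OF v, of n] proj_pair[of F H] act_eq_mult[of F] act_eq_mult[of H] by simp
  also have "\<dots> = scale (of_int n) (fst v * act 1, snd v * act 1)"
    using n(2) by (auto simp: scale_def simp flip: mult_smult_left)
  finally show ?thesis using n(1) by (simp add: scale_def prod_eq_iff poly_eq_iff)
qed

lemma trivial: "(\<forall>v\<in>four_group. \<pi> v = 0) \<or> (\<forall>v\<in>four_group. \<pi> v = v)"
proof -
  have 1: "(1, 0) \<in> four_group" using rpoly_in_four_group[of 1 0] by (simp add: one_pCons)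
  have "act 1 * act 1 = act 1"
    using idem[OF 1] proj_eq_mult[OF 1] proj_eq_mult[OF closed[OF 1]] by simp
  \<comment> \<open>Rational polynomials form an integral domain.\<close>
  then have "act 1 = 0 \<or> act 1 = 1" by auto
  then show ?thesis using proj_eq_mult by (auto simp: zero_prod_def)
qed

end

lemma add_indecomposable_four_group: "add_indecomposable four_group"
  by (rule add_indecomposableI, rule four_group_projection.trivial, unfold_locales) auto

section \<open>Encoding in the required type and conclusion\<close>

lemma inj_encode:
  "inj (\<lambda>v :: rat poly \<times> rat poly. \<lambda>n::nat. int (to_nat (coeffs (fst v), coeffs (snd v))))"
  by (rule injI) (auto simp: fun_eq_iff coeffs_eq_iff prod_eq_iff)

lemma funpow_add_scale: "((+) v ^^ n) 0 = scale (of_nat n) v"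
  by (induction n) (simp_all add: scale_def smult_add_left prod_eq_iff)

theorem mainTheorem5:
  shows "\<exists>G :: (nat \<Rightarrow> int) monoid.
    comm_group G \<and> torsion_free G \<and> Bassian_finite G \<and> \<not> relatively_co_Hopfian G"
proof -
  define e :: "rat poly \<times> rat poly \<Rightarrow> nat \<Rightarrow> int"
    where "e = (\<lambda>v n. int (to_nat (coeffs (fst v), coeffs (snd v))))"
  define d where "d = inv_into UNIV e"
  define G where "G = \<lparr>carrier = e ` four_group, monoid.mult = (\<lambda>x y. e (d x + d y)), one = e 0\<rparr>"
  interpret transported e d four_group G
    by unfold_locales
       (use inv_f_f[OF inj_encode] add_subgroup_four_group in \<open>simp_all add: G_def d_def e_def\<close>)
  have 1: "(1, 0) \<in> four_group" using rpoly_in_four_group[of 1 0] by (simp add: one_pCons)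
  \<comment> \<open>Constants in the first entry form a non-zero subgroup, and every polynomial in
    the image of \<open>shift\<close> has constant term 0.\<close>
  let ?B = "{v \<in> four_group. \<exists>c. v = ([:c:], 0)}"
  have zero: "0 \<in> four_group" using add_subgroup_four_group by (simp add: add_subgroup_def)
  have "torsion_free G"
    by (rule torsion_free_G) (auto simp: funpow_add_scale scale_def prod_eq_iff)
  moreover have "Bassian_finite G"
    by (rule Bassian_finite_G[OF add_indecomposable_four_group 1]) (simp add: zero_prod_def)
  moreover have "\<not> relatively_co_Hopfian G"
  proof (rule not_relatively_co_Hopfian_G)
    show "shift ` four_group \<subseteq> four_group" using shift_four_group by auto
    show "inj_on shift four_group" by (auto simp: inj_on_def shift_def)
    show "shift (x + y) = shift x + shift y" for x y by (simp add: shift_def)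
    have "(0, 0) \<in> four_group" using zero by (simp add: zero_prod_def)
    then show "add_subgroup ?B"
      using add_subgroup_four_group unfolding add_subgroup_def by (auto simp: zero_prod_def)
    show "?B \<subseteq> four_group" by auto
    have "(1, 0) \<in> ?B" using 1 by (auto simp: one_pCons)
    then show "?B \<noteq> {0}" by (metis Pair_inject one_neq_zero singletonD zero_prod_def)
    have "shift 0 = 0" by (simp add: shift_def zero_prod_def)
    then have "0 \<in> shift ` four_group" using zero by (metis image_eqI)
    moreover have "0 \<in> ?B" using zero by (simp add: zero_prod_def)
    moreover have "shift v = 0" if "shift v = ([:c:], 0)" for v c
      using that by (simp add: shift_def prod_eq_iff)
    ultimately show "shift ` four_group \<inter> ?B = {0}"
      by blast
  qed
  ultimately show ?thesis using comm_group_G by blast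
qed

end
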